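(* Let $q\in\mathbb{C}$ with $0<|q|<1$, and let $b,c\in\mathbb{C}\setminus\{0\}$ satisfy $|q|<|b|<|q|^{-1}$, $|q|<|c|<|q|^{-1}$, $|q|<|bc|<|q|^{-1}$ and $b\neq 1$, $c\neq 1$, $bc\neq 1$. Then $$\left\{ \sum_{r\geq 0} \frac{bq^r}{1-bq^r} - \sum_{r\geq 1} \frac{b^{-1}q^r}{1-b^{-1}q^r}-\sum_{r\geq 0} \frac{bcq^r}{1-bcq^r} + \sum_{r\geq 1} \frac{b^{-1}c^{-1}q^r}{1-b^{-1}c^{-1}q^r} \right\}\left\{ \sum_{r\geq 0} \frac{cq^r}{1-cq^r} - \sum_{r\geq 1} \frac{c^{-1}q^r}{1-c^{-1}q^r}-\sum_{r\geq 0} \frac{bcq^r}{1-bcq^r} + \sum_{r\geq 1} \frac{b^{-1}c^{-1}q^r}{1-b^{-1}c^{-1}q^r} \right\}$$ $$= \frac{bc}{(1-bc)^2}+\sum_{r \geq 1} r(b^rc^r + b^{-r}c^{-r})\frac{q^r}{1-q^r} +\sum_{r \geq 1} (b^r+b^{-r}+c^r+c^{-r}-b^rc^r-b^{-r}c^{-r} -2)\frac{q^r}{(1-q^r)^2}.$$ *)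

theory Defs
  imports "HOL-Analysis.Analysis"
begin

end

theory Submission
  imports Defs "HOL-Complex_Analysis.Complex_Analysis"
begin

text \<open>
  With \<open>u n = 1 / (1 - q^n)\<close>, each difference of Lambert series on the left equals
  \<open>L(b) - L(bc)\<close> or \<open>L(c) - L(bc)\<close>, where \<open>L(z)\<close> is the sum of \<open>u n * z^n\<close> over the nonzero
  integers \<open>n\<close> when \<open>|q| < |z| < 1\<close>. If \<open>b\<close> and \<open>c\<close> both lie in the unit disc, the product is
  expanded as a double Laurent series. The identity
  \<open>u i * u j = u i * u (j - i) + u (i - j) * u j\<close> kills every coefficient of \<open>b^i c^j\<close> off the axes
  and the diagonal, and it makes the convolution of \<open>u\<close> with itself on the diagonal telescope.
  Both sides being holomorphic, the result extends by analytic continuation, first in \<open>b\<close> for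
  fixed \<open>c\<close> in the unit disc and then in \<open>c\<close> for fixed \<open>b\<close>.
\<close>

section \<open>Unconditional sums over products and over the integers\<close>

lemma has_sum_Times_complex:
  fixes f :: "'a \<Rightarrow> complex" and g :: "'b \<Rightarrow> complex"
  assumes f: "(f has_sum a) A" and g: "(g has_sum b) B"
  shows "((\<lambda>(x, y). f x * g y) has_sum a * b) (A \<times> B)"
proof (rule has_sum_SigmaI)
  show "((\<lambda>y. case (x, y) of (x, y) \<Rightarrow> f x * g y) has_sum f x * b) B" for x
    using has_sum_cmult_right[OF g] by simp
  show "((\<lambda>x. f x * b) has_sum a * b) A"
    by (rule has_sum_cmult_left[OF f])
  have "(\<lambda>x. norm (f x)) summable_on A" "(\<lambda>y. norm (g y)) summable_on B"
    using f g has_sum_imp_summable summable_on_iff_abs_summable_on_complex by blast+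
  then have "(\<lambda>(x, y). norm (f x) * norm (g y)) summable_on A \<times> B"
    by (intro summable_on_SigmaI[where g = "\<lambda>x. norm (f x) * infsum (\<lambda>y. norm (g y)) B"])
       (auto intro!: has_sum_cmult_right has_sum_infsum summable_on_cmult_left)
  then show "(\<lambda>(x, y). f x * g y) summable_on A \<times> B"
    unfolding summable_on_iff_abs_summable_on_complex
    by (simp add: case_prod_unfold norm_mult)
qed

text \<open>Joins a power series in z and one in 1/z into a Laurent series. Index 0 is met by both
  halves, and \<open>f 0 = 0\<close> makes the double count harmless.\<close>

lemma has_sum_int_split:
  fixes f :: "int \<Rightarrow> 'a::real_normed_vector"
  assumes pos: "((\<lambda>n. f (int n)) has_sum a) UNIV"
    and neg: "((\<lambda>n. f (- int n)) has_sum b) UNIV"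
    and "f 0 = 0"
  shows "(f has_sum a + b) UNIV"
proof -
  have "(f has_sum a) {0..}"
    using pos
    by (subst has_sum_reindex_bij_witness[where i = int and j = nat and T = UNIV and h = "\<lambda>n. f (int n)" and s' = a]) auto
  moreover have "(f has_sum b) {..0}"
    using neg
    by (subst has_sum_reindex_bij_witness[where i = "\<lambda>n. - int n" and j = "\<lambda>n. nat (- n)" and T = UNIV and h = "\<lambda>n. f (- int n)" and s' = b]) auto
  then have "(f has_sum b) {..<0}"
    by (subst has_sum_cong_neutral[where T = "{..0}" and g = f])
       (use \<open>f 0 = 0\<close> in \<open>auto simp: order.order_iff_strict\<close>)
  ultimately have "(f has_sum a + b) ({0..} \<union> {..<0})"
    by (rule has_sum_Un_disjoint) auto
  moreover have "{0..} \<union> {..<0} = (UNIV :: int set)" by auto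
  ultimately show ?thesis by simp
qed

lemma suminf_Suc_eq:
  fixes f :: "nat \<Rightarrow> 'a::real_normed_vector"
  assumes "f sums s" "f 0 = 0"
  shows "(\<Sum>r. f (Suc r)) = s"
  using suminf_split_head[OF sums_summable[OF assms(1)]] sums_unique[OF assms(1)] assms(2) by simp

text \<open>Lets a single series be read as a double series supported on an axis or on the diagonal
  of the index plane.\<close>

lemma has_sum_inj_support:
  assumes "inj g" and "\<And>y. y \<notin> range g \<Longrightarrow> h y = 0"
  shows "((\<lambda>x. h (g x)) has_sum s) UNIV \<longleftrightarrow> (h has_sum s) UNIV"
proof -
  have "(h has_sum s) UNIV \<longleftrightarrow> (h has_sum s) (range g)"
    using assms(2) by (intro has_sum_cong_neutral) auto
  then show ?thesis using has_sum_reindex[OF assms(1), of h s] by (simp add: o_def)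
qed

section \<open>Lambert series: coefficients, convergence, holomorphy\<close>

locale nome =
  fixes q :: complex
  assumes q_nonzero: "q \<noteq> 0" and norm_q_less: "norm q < 1"
begin

lemma q_power_neq_1: "n > 0 \<Longrightarrow> q ^ n \<noteq> 1"
  by (metis norm_one norm_power norm_q_less norm_ge_zero power_less_one_iff less_irrefl)

text \<open>Since \<open>q ^ 0 = 1\<close>, division by zero makes all coefficients below vanish at index 0.\<close>

definition lam :: "nat \<Rightarrow> complex" where "lam n = q ^ n / (1 - q ^ n)"
definition lam2 :: "nat \<Rightarrow> complex" where "lam2 n = q ^ n / (1 - q ^ n)\<^sup>2"
definition nlam :: "nat \<Rightarrow> complex" where "nlam n = of_nat n * lam n"

definition lambert :: "complex \<Rightarrow> complex" where "lambert z = (\<Sum>n. lam n * z ^ n)"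
definition lambert2 :: "complex \<Rightarrow> complex" where "lambert2 z = (\<Sum>n. lam2 n * z ^ n)"
definition nlambert :: "complex \<Rightarrow> complex" where "nlambert z = (\<Sum>n. nlam n * z ^ n)"

lemma lam_0 [simp]: "lam 0 = 0" "lam2 0 = 0" "nlam 0 = 0"
  by (simp_all add: lam_def lam2_def nlam_def)

lemma norm_q_less_inverse: "1 < inverse (norm q)"
  using norm_q_less q_nonzero by (simp add: field_simps)

lemma annulusD:
  fixes z :: complex
  assumes "norm q < norm z" "norm z < inverse (norm q)"
  shows "z \<noteq> 0" "norm z * norm q < 1" "norm (inverse z) * norm q < 1"
proof -
  show "z \<noteq> 0" using assms(1) by auto
  then show "norm z * norm q < 1" "norm (inverse z) * norm q < 1"
    using assms q_nonzero by (auto simp: norm_inverse norm_divide field_simps)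
qed

text \<open>Majorant: the differentiated geometric series at |z| |q|. The factor
  \<open>real n\<close> is there for \<open>nlam\<close>; keeping it lets one bound serve
  \<open>lam\<close> and \<open>lam2\<close> too, since these vanish at index 0.\<close>

lemma summable_norm_coeff:
  fixes a :: "nat \<Rightarrow> complex"
  assumes a: "\<And>n. norm (a n) \<le> C * (real n * norm q ^ n)" and z: "norm z * norm q < 1"
  shows "summable (\<lambda>n. norm (a n * z ^ n))"
proof (rule summable_comparison_test')
  have "summable (\<lambda>n. of_nat n * (norm z * norm q) ^ n)"
    using summable_mult[OF sums_summable[OF geometric_deriv_sums[of "norm z * norm q"]], of "norm z * norm q"] z
    by (subst summable_Suc_iff[symmetric]) (simp add: mult_ac)
  then show "summable (\<lambda>n. C * (of_nat n * (norm z * norm q) ^ n))"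
    by (rule summable_mult)
  fix n
  show "norm (norm (a n * z ^ n)) \<le> C * (of_nat n * (norm z * norm q) ^ n)"
    using mult_right_mono[OF a[of n], of "norm z ^ n"]
    by (simp add: norm_mult norm_power power_mult_distrib mult_ac)
qed

lemma norm_one_minus_q_power: "n > 0 \<Longrightarrow> 1 - norm q \<le> norm (1 - q ^ n)"
proof -
  assume "n > 0"
  have "norm q ^ n \<le> norm q ^ 1"
    using \<open>n > 0\<close> norm_q_less by (intro power_decreasing) auto
  then show ?thesis
    using norm_triangle_ineq2[of 1 "q ^ n"] by (simp add: norm_power)
qed

lemma norm_lam_le: "norm (lam n) \<le> 1 / (1 - norm q) * norm q ^ n"
proof (cases "n = 0")
  case False
  then have "norm q ^ n / norm (1 - q ^ n) \<le> norm q ^ n / (1 - norm q)"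
    using norm_one_minus_q_power[of n] norm_q_less
    by (intro divide_left_mono mult_pos_pos) (auto intro: less_le_trans[of _ "1 - norm q"])
  then show ?thesis by (simp add: lam_def norm_divide norm_power)
qed (use norm_q_less in simp)

lemma norm_coeff_le:
  "norm (lam n) \<le> 1 / (1 - norm q) * (real n * norm q ^ n)"
  "norm (nlam n) \<le> 1 / (1 - norm q) * (real n * norm q ^ n)"
  "norm (lam2 n) \<le> 1 / (1 - norm q)\<^sup>2 * (real n * norm q ^ n)"
proof -
  show "norm (nlam n) \<le> 1 / (1 - norm q) * (real n * norm q ^ n)"
    using mult_left_mono[OF norm_lam_le[of n], of "real n"]
    by (simp add: nlam_def norm_mult mult_ac)
  show "norm (lam n) \<le> 1 / (1 - norm q) * (real n * norm q ^ n)"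
  proof (cases "n = 0")
    case False
    have "1 * (1 / (1 - norm q) * norm q ^ n) \<le> real n * (1 / (1 - norm q) * norm q ^ n)"
      using False norm_q_less by (intro mult_right_mono) auto
    then show ?thesis using norm_lam_le[of n] by (simp add: mult_ac)
  qed simp
  show "norm (lam2 n) \<le> 1 / (1 - norm q)\<^sup>2 * (real n * norm q ^ n)"
  proof (cases "n = 0")
    case False
    have "norm (lam2 n) = norm q ^ n / (norm (1 - q ^ n))\<^sup>2"
      by (simp add: lam2_def norm_divide norm_power)
    also have "\<dots> \<le> norm q ^ n / (1 - norm q)\<^sup>2"
      using norm_one_minus_q_power[of n] norm_q_less False
      by (intro divide_left_mono power_mono mult_pos_pos zero_less_power) auto
    also have "\<dots> \<le> real n * (norm q ^ n / (1 - norm q)\<^sup>2)"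
      using mult_right_mono[of 1 "real n" "norm q ^ n / (1 - norm q)\<^sup>2"] False by simp
    finally show ?thesis by simp
  qed simp
qed

lemmas summable_norm_lam = summable_norm_coeff[OF norm_coeff_le(1)]
  and summable_norm_nlam = summable_norm_coeff[OF norm_coeff_le(2)]
  and summable_norm_lam2 = summable_norm_coeff[OF norm_coeff_le(3)]

lemma has_sum_lambert: "norm z * norm q < 1 \<Longrightarrow> ((\<lambda>n. lam n * z ^ n) has_sum lambert z) UNIV"
  unfolding lambert_def by (intro norm_summable_imp_has_sum summable_norm_lam summable_sums summable_norm_cancel)

lemma has_sum_lambert2: "norm z * norm q < 1 \<Longrightarrow> ((\<lambda>n. lam2 n * z ^ n) has_sum lambert2 z) UNIV"
  unfolding lambert2_def by (intro norm_summable_imp_has_sum summable_norm_lam2 summable_sums summable_norm_cancel)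

lemma has_sum_nlambert: "norm z * norm q < 1 \<Longrightarrow> ((\<lambda>n. nlam n * z ^ n) has_sum nlambert z) UNIV"
  unfolding nlambert_def by (intro norm_summable_imp_has_sum summable_norm_nlam summable_sums summable_norm_cancel)

text \<open>A power series is holomorphic in its disc of convergence, here of radius at least 1/|q|.
  The inner function \<open>g\<close> covers arguments such as 1/z and b z at once.\<close>

lemma holomorphic_series: 
  assumes "\<And>z. norm z * norm q < 1 \<Longrightarrow> ((\<lambda>n. a n * z ^ n) has_sum F z) UNIV"
    and g: "g holomorphic_on S" and gS: "\<And>z. z \<in> S \<Longrightarrow> norm (g z) * norm q < 1"
  shows "(\<lambda>z. F (g z)) holomorphic_on S"
proof -
  have "F holomorphic_on ball 0 (1 / norm q)"
    using assms(1) q_nonzero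
    by (intro power_series_holomorphic[where a = a]) (auto intro!: has_sum_imp_sums simp: field_simps)
  moreover have "g ` S \<subseteq> ball 0 (1 / norm q)"
    using gS q_nonzero by (auto simp: field_simps)
  ultimately show ?thesis
    using holomorphic_on_compose_gen[OF g, of F] by (simp add: o_def)
qed

lemmas holomorphic_lambert = holomorphic_series[OF has_sum_lambert]
  and holomorphic_lambert2 = holomorphic_series[OF has_sum_lambert2]
  and holomorphic_nlambert = holomorphic_series[OF has_sum_nlambert]

text \<open>Lambert's rearrangement: both series are iterated sums of z^m q^(m k) over m, k >= 1.
  Summing over m first gives the fractions in z, summing over k first gives the coefficients
  \<open>lam m\<close>.\<close>

lemma lambert_sums:
  assumes z: "norm z * norm q < 1"
  shows "(\<lambda>r. z * q ^ Suc r / (1 - z * q ^ Suc r)) sums lambert z"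
proof -
  define f where "f = (\<lambda>(n, r). z ^ Suc n * q ^ (Suc n * Suc r))"
  have zq: "norm (z * q ^ Suc r) < 1" for r
  proof -
    have "norm z * norm q ^ Suc r \<le> norm z * norm q ^ 1"
      using norm_q_less by (intro mult_left_mono power_decreasing) auto
    then show ?thesis using z by (simp add: norm_mult norm_power)
  qed
  have geo: "((\<lambda>k. x ^ Suc k) has_sum x / (1 - x)) UNIV" if "norm x < 1" for x :: complex
  proof (rule norm_summable_imp_has_sum)
    show "summable (\<lambda>k. norm (x ^ Suc k))"
      using that by (simp add: norm_power norm_mult summable_geometric summable_mult)
    show "(\<lambda>k. x ^ Suc k) sums (x / (1 - x))"
      using sums_mult[OF geometric_sums[OF that], of x] by simp
  qed
  have inner_r: "((\<lambda>r. f (n, r)) has_sum lam (Suc n) * z ^ Suc n) UNIV" for n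
  proof -
    have "norm (q ^ Suc n) < 1"
      using norm_q_less power_Suc_less_one[of "norm q" n] q_nonzero by (simp add: norm_power del: power_Suc)
    from has_sum_cmult_right[OF geo[OF this], of "z ^ Suc n"] show ?thesis
      unfolding f_def lam_def prod.case power_mult[symmetric] by (simp only: mult_ac)
  qed
  have inner_n: "((\<lambda>n. f (n, r)) has_sum (z * q ^ Suc r) / (1 - z * q ^ Suc r)) UNIV" for r
  proof -
    have "f (n, r) = (z * q ^ Suc r) ^ Suc n" for n
      by (simp only: f_def prod.case power_mult_distrib power_mult[symmetric] mult.commute[of "Suc n"])
    then show ?thesis using geo[OF zq[of r]] by simp
  qed
  have "((\<lambda>n. lam n * z ^ n) has_sum lambert z) (range Suc)"
    using has_sum_lambert[OF z]
    by (subst has_sum_cong_neutral[where T = UNIV and g = "\<lambda>n. lam n * z ^ n"])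
       (auto simp: image_iff gr0_conv_Suc, metis lam_0(1) not0_implies_Suc)
  then have lambert: "((\<lambda>n. lam (Suc n) * z ^ Suc n) has_sum lambert z) UNIV"
    by (subst (asm) has_sum_reindex) (auto simp: o_def)
  \<comment> \<open>Since (n+1)(r+1) = (n+1) + r + n r, each term is dominated by a term of a
    product of two geometric series.\<close>
  have "(\<lambda>x. norm (f x)) summable_on UNIV \<times> UNIV"
  proof (rule summable_on_comparison_test)
    have "((\<lambda>n. (z * q) ^ Suc n) has_sum (z * q) / (1 - z * q)) UNIV"
      by (rule geo) (use z in \<open>simp add: norm_mult\<close>)
    moreover have "((\<lambda>r. q ^ r) has_sum (1 / (1 - q))) UNIV"
      using norm_q_less
      by (intro norm_summable_imp_has_sum geometric_sums) (auto simp: norm_power summable_geometric)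
    ultimately show "(\<lambda>x. norm ((\<lambda>(n, r). (z * q) ^ Suc n * q ^ r) x)) summable_on UNIV \<times> UNIV"
      using has_sum_Times_complex has_sum_imp_summable summable_on_iff_abs_summable_on_complex by blast
  next
    fix x :: "nat \<times> nat"
    obtain n r where x: "x = (n, r)" by force
    have "norm q ^ (Suc n * Suc r) \<le> norm q ^ (Suc n + r)"
      using norm_q_less by (intro power_decreasing) auto
    then have "norm z ^ Suc n * norm q ^ (Suc n * Suc r) \<le> norm z ^ Suc n * norm q ^ (Suc n + r)"
      by (intro mult_left_mono) auto
    also have "\<dots> = (norm z * norm q) ^ Suc n * norm q ^ r"
      by (simp only: power_mult_distrib power_add mult_ac)
    finally show "norm (f x) \<le> norm ((\<lambda>(n, r). (z * q) ^ Suc n * q ^ r) x)"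
      by (simp only: f_def x prod.case norm_mult norm_power)
  qed auto
  then have "f summable_on UNIV \<times> UNIV"
    using summable_on_iff_abs_summable_on_complex by blast
  then obtain s where s: "(f has_sum s) (UNIV \<times> UNIV)"
    using summable_iff_has_sum_infsum by blast
  have "s = lambert z"
    using has_sum_SigmaD[OF s inner_r] lambert has_sum_unique by blast
  have "((\<lambda>(r, n). f (n, r)) has_sum s) (UNIV \<times> UNIV)"
    using s has_sum_swap[where f = f and S = s and A = UNIV and B = UNIV] by simp
  then have "((\<lambda>r. z * q ^ Suc r / (1 - z * q ^ Suc r)) has_sum s) UNIV"
    by (rule has_sum_SigmaD) (use inner_n in simp)
  with \<open>s = lambert z\<close> show ?thesis by (simp add: has_sum_imp_sums del: power_Suc)
qed

text \<open>This is -z theta'(z)/theta(z) for theta(z) = prod_{r>=0} (1 - z q^r)(1 - q^(r+1)/z). The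
  term z/(1 - z), from r = 0, carries the only pole in the annulus |q| < |z| < 1/|q|.\<close>

definition zeta :: "complex \<Rightarrow> complex" where
  "zeta z = z / (1 - z) + lambert z - lambert (inverse z)"

lemma zeta_eq:
  assumes "norm q < norm z" "norm z < inverse (norm q)" 
  shows "zeta z = (\<Sum>r. z * q ^ r / (1 - z * q ^ r)) -
    (\<Sum>r. inverse z * q ^ Suc r / (1 - inverse z * q ^ Suc r))"
proof -
  have 1: "norm z * norm q < 1" "norm (inverse z) * norm q < 1"
    using annulusD[OF assms] by simp_all
  have "(\<lambda>r. z * q ^ r / (1 - z * q ^ r)) sums (lambert z + z * q ^ 0 / (1 - z * q ^ 0))"
    by (rule sums_Suc) (rule lambert_sums[OF 1(1)])
  then show ?thesis
    using sums_unique[OF lambert_sums[OF 1(2)]] by (simp add: zeta_def sums_iff)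
qed

text \<open>The first three summands are the q-expansion of the Weierstrass function, up to scaling
  and an additive constant. The \<open>lambert2\<close> terms are included so that
  \<open>wp (b * c)\<close> collects everything on the right that depends on the product bc.\<close>

definition wp :: "complex \<Rightarrow> complex" where
  "wp z = z / (1 - z)\<^sup>2 + nlambert z + nlambert (inverse z) - lambert2 z - lambert2 (inverse z)"

section \<open>The two-sided coefficients and their product relation\<close>

definition u :: "int \<Rightarrow> complex" where "u n = inverse (1 - q powi n)"

lemma u_0 [simp]: "u 0 = 0"
  by (simp add: u_def)

lemma powi_neq_1: "n \<noteq> 0 \<Longrightarrow> q powi n \<noteq> 1"
proof -
  assume "n \<noteq> 0"
  then have "nat \<bar>n\<bar> > 0" by simp
  from q_power_neq_1[OF this] show ?thesis
    by (auto simp: power_int_def power_inverse split: if_splits)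
qed

lemma u_pos: "n > 0 \<Longrightarrow> u (int n) = 1 + lam n"
  using q_power_neq_1[of n] by (simp add: u_def lam_def field_simps)

lemma u_neg: "u (- int n) = - lam n"
proof (cases "n = 0")
  case False
  then show ?thesis
    using q_power_neq_1[of n] q_nonzero
    by (simp add: u_def lam_def power_int_minus divide_simps) (simp add: algebra_simps)
qed simp

lemma u_mult_minus: "u (int n) * u (- int n) = - lam2 n"
proof (cases "n = 0")
  case False
  then have "u (int n) = 1 / (1 - q ^ n)"
    by (simp add: u_def divide_inverse)
  then show ?thesis
    by (simp add: u_neg lam_def lam2_def power2_eq_square)
qed simp

text \<open>Partial fractions: with x = q^i and y = q^j, divide x(1 - y) - y(1 - x) = x - y by (x -
  y)(1 - x)(1 - y). On the excluded lines the default \<open>u 0 = 0\<close> spoils the relation,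
  and these failures produce all surviving terms later.\<close>

lemma u_mult_u:
  assumes "i \<noteq> 0" "j \<noteq> 0" "i \<noteq> j"
  shows "u i * u j = u i * u (j - i) + u (i - j) * u j"
proof -
  define x y where "x = q powi i" and "y = q powi j"
  have "x \<noteq> 0" "y \<noteq> 0" using q_nonzero by (auto simp: x_def y_def)
  have xy: "q powi (i - j) = x / y" "q powi (j - i) = y / x"
    using q_nonzero by (simp_all add: power_int_diff x_def y_def)
  have "x \<noteq> 1" "y \<noteq> 1" "x \<noteq> y"
    using powi_neq_1[of i] powi_neq_1[of j] powi_neq_1[of "i - j"] assms xy \<open>y \<noteq> 0\<close> 
    by (auto simp: x_def y_def)
  then have inv: "inverse (1 - y / x) = x / (x - y)" "inverse (1 - x / y) = - (y / (x - y))"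
    using \<open>x \<noteq> 0\<close> \<open>y \<noteq> 0\<close> by (simp_all add: divide_simps) (simp_all add: algebra_simps)
  have "x / (x - y) * (1 - y) - y / (x - y) * (1 - x) = (x * (1 - y) - y * (1 - x)) / (x - y)"
    by (simp only: diff_divide_distrib times_divide_eq_left)
  also have "\<dots> = 1"
    using \<open>x \<noteq> y\<close> by (simp add: algebra_simps)
  finally have "x / (x - y) * (1 - y) - y / (x - y) * (1 - x) = 1" .
  moreover have "inverse (1 - x) * (1 - x) = 1" "inverse (1 - y) * (1 - y) = 1"
    using \<open>x \<noteq> 1\<close> \<open>y \<noteq> 1\<close> by simp_all
  \<comment> \<open>Multiply the first equation by both inverses and cancel with the other
    two.\<close>
  ultimately have "inverse (1 - x) * inverse (1 - y) =
      inverse (1 - x) * (x / (x - y)) + - (y / (x - y)) * inverse (1 - y)"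
    by algebra
  then show ?thesis
    by (simp only: u_def xy inv flip: x_def y_def)
qed

section \<open>Laurent expansions\<close>

text \<open>As u n = 1 + \<open>lam n\<close> for n > 0, the positive half is a geometric series
  plus \<open>lambert z\<close>; the geometric part confines the expansion to |z| < 1. The negative
  half is -\<open>lambert\<close> at 1/z.\<close>

lemma has_sum_zeta:
  assumes "norm q < norm z" "norm z < 1"
  shows "((\<lambda>n. u n * z powi n) has_sum zeta z) UNIV"
proof -
  have z: "z \<noteq> 0" "norm z * norm q < 1" "norm (inverse z) * norm q < 1"
    using assms annulusD[of z] norm_q_less_inverse by auto
  have geo: "((\<lambda>n. if n = 0 then 0 else z ^ n) has_sum z / (1 - z)) UNIV"
  proof (rule norm_summable_imp_has_sum)
    show "summable (\<lambda>n. norm (if n = 0 then 0 else z ^ n))"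
      using assms(2) by (subst summable_Suc_iff[symmetric]) (simp add: norm_mult norm_power summable_geometric summable_mult)
    show "(\<lambda>n. if n = 0 then 0 else z ^ n) sums (z / (1 - z))"
      using sums_Suc[of "\<lambda>n. if n = 0 then 0 else z ^ n" "z / (1 - z)"] 
        sums_mult[OF geometric_sums[OF assms(2)], of z] by simp
  qed
  have eq: "u (int n) * z powi int n = (if n = 0 then 0 else z ^ n) + lam n * z ^ n" for n
    by (cases "n = 0") (simp_all add: u_pos algebra_simps)
  have "((\<lambda>n. u (int n) * z powi int n) has_sum z / (1 - z) + lambert z) UNIV"
    unfolding eq by (intro has_sum_add geo has_sum_lambert z)
  moreover have "((\<lambda>n. u (- int n) * z powi (- int n)) has_sum - lambert (inverse z)) UNIV"
    using has_sum_uminusI[OF has_sum_lambert[OF z(3)]]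
    by (simp add: u_neg power_int_minus power_inverse)
  ultimately have "((\<lambda>n. u n * z powi n) has_sum z / (1 - z) + lambert z + - lambert (inverse z)) UNIV"
    by (rule has_sum_int_split) auto
  then show ?thesis by (simp add: zeta_def)
qed

text \<open>Here the coefficients decay like |q|^|n| in both directions, so the expansion holds on
  the whole annulus. The value z = 1 is used for the constant term of a convolution.\<close>

lemma has_sum_lambert2_int:
  assumes "norm q < norm z" "norm z < inverse (norm q)"
  shows "((\<lambda>n. - (u n * u (- n)) * z powi n) has_sum lambert2 z + lambert2 (inverse z)) UNIV"
proof (rule has_sum_int_split)
  show "((\<lambda>n. - (u (int n) * u (- int n)) * z powi int n) has_sum lambert2 z) UNIV"
    using has_sum_lambert2[of z] annulusD[OF assms] by (simp add: u_mult_minus)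
  show "((\<lambda>n. - (u (- int n) * u (- (- int n))) * z powi (- int n)) has_sum lambert2 (inverse z)) UNIV"
    using has_sum_lambert2[of "inverse z"] annulusD[OF assms] u_mult_minus
    by (simp add: mult.commute[of "u (- int _)"] power_int_minus power_inverse)
qed auto

text \<open>Formally z d/dz applied to the expansion of \<open>zeta\<close>; the geometric part
  becomes z/(1 - z)^2.\<close>

lemma has_sum_nlambert_int:
  assumes "norm q < norm z" "norm z < 1"
  shows "((\<lambda>n. of_int n * u n * z powi n) has_sum z / (1 - z)\<^sup>2 + nlambert z + nlambert (inverse z)) UNIV"
proof -
  have z: "z \<noteq> 0" "norm z * norm q < 1" "norm (inverse z) * norm q < 1"
    using assms annulusD[of z] norm_q_less_inverse by auto
  have geo: "((\<lambda>n. of_nat n * z ^ n) has_sum z / (1 - z)\<^sup>2) UNIV"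
  proof (rule norm_summable_imp_has_sum)
    show "summable (\<lambda>n. norm (of_nat n * z ^ n))"
      using summable_mult[OF sums_summable[OF geometric_deriv_sums[of "norm z"]], of "norm z"] assms(2)
      by (subst summable_Suc_iff[symmetric]) (simp add: norm_mult norm_power mult_ac flip: of_nat_Suc del: of_nat_Suc)
    show "(\<lambda>n. of_nat n * z ^ n) sums (z / (1 - z)\<^sup>2)"
      using sums_Suc[of "\<lambda>n. of_nat n * z ^ n" "z / (1 - z)\<^sup>2"] 
        sums_mult[OF geometric_deriv_sums[OF assms(2)], of z] by (simp add: mult_ac)
  qed
  have eq: "of_int (int n) * u (int n) * z powi int n = of_nat n * z ^ n + nlam n * z ^ n" for n
    by (cases "n = 0") (simp_all add: u_pos nlam_def algebra_simps)
  have "((\<lambda>n. of_int (int n) * u (int n) * z powi int n) has_sum z / (1 - z)\<^sup>2 + nlambert z) UNIV"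
    unfolding eq by (intro has_sum_add geo has_sum_nlambert z)
  moreover have "((\<lambda>n. of_int (- int n) * u (- int n) * z powi (- int n)) has_sum nlambert (inverse z)) UNIV"
    using has_sum_nlambert[OF z(3)]
    by (simp add: u_neg nlam_def power_int_minus power_inverse)
  ultimately show ?thesis
    by (rule has_sum_int_split) auto
qed

section \<open>The convolution of u with itself\<close>

text \<open>u tends to 1 at +infinity and to 0 at -infinity, so the sum telescopes to i. To make
  this rigorous, the unit step is subtracted: the remainder \<open>e\<close> is summable, so its
  shift has the same sum, and the difference of the two steps has i as its finite signed
  count.\<close>

lemma has_sum_u_telescope: "((\<lambda>n. u n - u (n - i)) has_sum of_int i) UNIV"
proof -
  define e where "e n = u n - (if n > 0 then 1 else 0)" for n
  have "((\<lambda>n. lam n * 1 ^ n) has_sum lambert 1) UNIV"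
    by (rule has_sum_lambert) (use norm_q_less in simp)
  then have lambert: "(lam has_sum lambert 1) UNIV" by simp
  have "(e has_sum lambert 1 + - lambert 1) UNIV"
  proof (rule has_sum_int_split)
    have "e (int n) = lam n" for n by (cases "n = 0") (simp_all add: e_def u_pos)
    then show "((\<lambda>n. e (int n)) has_sum lambert 1) UNIV" using lambert by simp
    show "((\<lambda>n. e (- int n)) has_sum - lambert 1) UNIV"
      using has_sum_uminusI[OF lambert] by (simp add: e_def u_neg)
  qed (simp add: e_def)
  then have e: "(e has_sum 0) UNIV" by simp
  have "((\<lambda>n. e (n - i)) has_sum 0) UNIV"
    using e by (subst has_sum_reindex_bij_witness[where i = "\<lambda>n. n + i" and j = "\<lambda>n. n - i" and T = UNIV and h = e and s' = 0]) auto
  with e have 1: "((\<lambda>n. e n + - e (n - i)) has_sum 0 + - 0) UNIV"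
    by (intro has_sum_add has_sum_uminusI)
  have 2: "((\<lambda>n. (if n > 0 then 1 else 0) - (if n > i then 1 else 0)) has_sum (of_int i :: complex)) UNIV"
  proof (cases "i \<ge> 0")
    case True
    show ?thesis
      by (rule has_sum_finite_neutralI[of "{1..i}"]) (use True in auto)
  next
    case False
    show ?thesis
      by (rule has_sum_finite_neutralI[of "{i+1..0}"]) (use False in auto)
  qed
  have "u n - u (n - i) =
      (e n + - e (n - i)) + ((if n > 0 then 1 else 0) - (if n > i then 1 else 0))" for n
    by (simp add: e_def)
  then show ?thesis using has_sum_add[OF 1 2] by simp
qed

lemma has_sum_convolution:
  assumes "i \<noteq> 0"
  shows "((\<lambda>n. u n * u (i - n)) has_sum of_int i * u i + u i * u (- i) - (u i)\<^sup>2) UNIV"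
proof -
  have 1: "((\<lambda>n. u i * (u n - u (n - i))) has_sum u i * of_int i) UNIV"
    by (rule has_sum_cmult_right[OF has_sum_u_telescope])
  have 2: "((\<lambda>n. if n = 0 then u i * u (- i) else 0) has_sum u i * u (- i)) UNIV"
    by (rule has_sum_finite_neutralI[of "{0}"]) auto
  have 3: "((\<lambda>n. if n = i then - (u i)\<^sup>2 else 0) has_sum - (u i)\<^sup>2) UNIV"
    by (rule has_sum_finite_neutralI[of "{i}"]) auto
  \<comment> \<open>Away from n = 0 and n = i this is \<open>u_mult_u\<close> for the pair (i, n).
    At these two indices the left side is 0, and the extra terms cancel -u(i) u(-i) and u(i)^2
    respectively.\<close>
  have eq: "u n * u (i - n) = u i * (u n - u (n - i)) +
      (if n = 0 then u i * u (- i) else 0) + (if n = i then - (u i)\<^sup>2 else 0)" for n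
  proof (cases "n = 0 \<or> n = i")
    case False
    then have "u i * u n = u i * u (n - i) + u (i - n) * u n"
      using assms by (intro u_mult_u) auto
    with False show ?thesis by (simp add: algebra_simps)
  qed (use assms in \<open>auto simp: power2_eq_square\<close>)
  show ?thesis
    unfolding eq using has_sum_add[OF has_sum_add[OF 1 2] 3] by (simp add: mult_ac)
qed

section \<open>The identity inside the unit disc\<close>

definition product_identity :: "complex \<Rightarrow> complex \<Rightarrow> bool" where
  "product_identity b c \<longleftrightarrow> (zeta b - zeta (b * c)) * (zeta c - zeta (b * c)) =
    wp (b * c) + (lambert2 b + lambert2 (inverse b)) + (lambert2 c + lambert2 (inverse c)) - 2 * lambert2 1"

lemma product_identity_near:
  assumes b: "norm b < 1" and c: "norm c < 1" and bc: "norm q < norm (b * c)"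
  shows "product_identity b c"
proof -
  define x where "x = b * c"
  have nz: "b \<noteq> 0" "c \<noteq> 0" "x \<noteq> 0" using bc q_nonzero by (auto simp: x_def)
  have x: "norm q < norm x" "norm x < 1"
    using bc mult_strict_mono[OF b c] by (auto simp: x_def norm_mult)
  \<comment> \<open>So b, c and bc all lie in |q| < |z| < 1, where \<open>has_sum_zeta\<close>
    applies.\<close>
  have "norm x \<le> norm b" "norm x \<le> norm c"
    using b c mult_left_mono[of "norm c" 1 "norm b"] mult_right_mono[of "norm b" 1 "norm c"]
    by (auto simp: x_def norm_mult)
  with x have qb: "norm q < norm b" and qc: "norm q < norm c" by auto
  note inv = norm_q_less_inverse
  note Mb = has_sum_zeta[OF qb b] and Mc = has_sum_zeta[OF qc c] and Mx = has_sum_zeta[OF x]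
  let ?Q = "UNIV \<times> UNIV :: (int \<times> int) set"
  have p1: "((\<lambda>(i, j). u i * u j * (b powi i * c powi j)) has_sum zeta b * zeta c) ?Q"
    using has_sum_Times_complex[OF Mb Mc] by (simp add: mult_ac)
  \<comment> \<open>Because x^n c^m = b^n c^(n+m), reindexing by (n, n + m) yields the coefficient
    of b^i c^j in the shape of \<open>u_mult_u\<close>; \<open>p3\<close> is the mirror
    image.\<close>
  have p2: "((\<lambda>(i, j). u i * u (j - i) * (b powi i * c powi j)) has_sum zeta x * zeta c) ?Q"
    using has_sum_Times_complex[OF Mx Mc]
    by (subst has_sum_reindex_bij_witness[where i = "\<lambda>(n, m). (n, n + m)" and j = "\<lambda>(i, j). (i, j - i)"
          and T = ?Q and h = "\<lambda>(n, m). u n * x powi n * (u m * c powi m)" and s' = "zeta x * zeta c"])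
       (use nz in \<open>auto simp: x_def power_int_mult_distrib power_int_diff\<close>)
  have p3: "((\<lambda>(i, j). u (i - j) * u j * (b powi i * c powi j)) has_sum zeta b * zeta x) ?Q"
    using has_sum_Times_complex[OF Mb Mx]
    by (subst has_sum_reindex_bij_witness[where i = "\<lambda>(n, m). (n + m, m)" and j = "\<lambda>(i, j). (i - j, j)"
          and T = ?Q and h = "\<lambda>(n, m). u n * b powi n * (u m * x powi m)" and s' = "zeta b * zeta x"])
       (use nz in \<open>auto simp: x_def power_int_mult_distrib power_int_diff\<close>)
  have p4: "((\<lambda>(i, n). u n * u (i - n) * x powi i) has_sum zeta x * zeta x) ?Q"
    using has_sum_Times_complex[OF Mx Mx]
    by (subst has_sum_reindex_bij_witness[where i = "\<lambda>(n, m). (n + m, n)" and j = "\<lambda>(i, n). (n, i - n)"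
          and T = ?Q and h = "\<lambda>(n, m). u n * x powi n * (u m * x powi m)" and s' = "zeta x * zeta x"])
       (use nz in \<open>auto simp: power_int_diff\<close>)

  \<comment> \<open>The coefficient of x^i in zeta(x)^2. For i = 0 it is the sum of u(n) u(-n), in
    which n and -n each contribute -\<open>lam2\<close>.\<close>
  define conv where "conv i = (if i = 0 then - 2 * lambert2 1 else of_int i * u i + u i * u (- i) - (u i)\<^sup>2)" for i
  have conv: "((\<lambda>n. u n * u (i - n)) has_sum conv i) UNIV" for i
  proof (cases "i = 0")
    case True
    have "((\<lambda>n. - (u n * u (- n)) * 1 powi n) has_sum lambert2 1 + lambert2 (inverse 1)) UNIV"
      by (rule has_sum_lambert2_int) (use norm_q_less inv in auto)
    from has_sum_uminusI[OF this] show ?thesis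
      using True by (simp add: conv_def)
  next
    case False
    then show ?thesis using has_sum_convolution[of i] by (simp add: conv_def)
  qed
  have "((\<lambda>i. conv i * x powi i) has_sum zeta x * zeta x) UNIV"
    by (rule has_sum_SigmaD[OF p4]) (use has_sum_cmult_left[OF conv] in simp)

  \<comment> \<open>The three double series with their contributions from the axes removed. Only the
    diagonal is left, with coefficients u(i)^2, which cancel the -u(i)^2 in
    \<open>conv i\<close>.\<close>
  moreover define S where "S = zeta b * zeta c - zeta x * zeta c - zeta b * zeta x - (lambert2 b + lambert2 (inverse b)) - (lambert2 c + lambert2 (inverse c))"
  have "((\<lambda>i. (u i)\<^sup>2 * x powi i) has_sum S) UNIV"
  proof -
    \<comment> \<open>\<open>hb\<close>, \<open>hc\<close> and \<open>d\<close> live on the lines j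
      = 0, i = 0 and i = j, exactly where \<open>u_mult_u\<close> fails; all three vanish at the
      origin.\<close>
    define hb where "hb = (\<lambda>(i :: int, j :: int). if j = 0 then - (u i * u (- i)) * b powi i else 0)"
    define hc where "hc = (\<lambda>(i :: int, j :: int). if i = 0 then - (u j * u (- j)) * c powi j else 0)"
    define d where "d = (\<lambda>(i :: int, j :: int). if i = j then (u i)\<^sup>2 * x powi i else 0)"
    have "(hb has_sum lambert2 b + lambert2 (inverse b)) UNIV"
      using has_sum_lambert2_int[of b] qb b inv
      by (subst has_sum_inj_support[symmetric, where g = "\<lambda>i. (i, 0)"])
         (auto simp: hb_def inj_on_def)
    moreover have "(hc has_sum lambert2 c + lambert2 (inverse c)) UNIV"
      using has_sum_lambert2_int[of c] qc c inv
      by (subst has_sum_inj_support[symmetric, where g = "\<lambda>j. (0, j)"])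
         (auto simp: hc_def inj_on_def)
    ultimately have "((\<lambda>p. (\<lambda>(i, j). u i * u j * (b powi i * c powi j)) p
        + - (\<lambda>(i, j). u i * u (j - i) * (b powi i * c powi j)) p
        + - (\<lambda>(i, j). u (i - j) * u j * (b powi i * c powi j)) p
        + - hb p + - hc p) has_sum
        zeta b * zeta c + - (zeta x * zeta c) + - (zeta b * zeta x) + - (lambert2 b + lambert2 (inverse b)) + - (lambert2 c + lambert2 (inverse c))) UNIV"
      using p1 p2 p3 by (intro has_sum_add has_sum_uminusI) (simp_all only: UNIV_Times_UNIV)
    moreover have "(\<lambda>(i, j). u i * u j * (b powi i * c powi j)) p
        + - (\<lambda>(i, j). u i * u (j - i) * (b powi i * c powi j)) p
        + - (\<lambda>(i, j). u (i - j) * u j * (b powi i * c powi j)) p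
        + - hb p + - hc p = d p" for p
    proof -
      obtain i j where p: "p = (i, j)" by force
      consider "i = 0" | "j = 0" "i \<noteq> 0" | "i = j" "i \<noteq> 0" | "i \<noteq> 0" "j \<noteq> 0" "i \<noteq> j" by blast
      then show ?thesis
      proof cases
        case 4
        have "(u i * u j - u i * u (j - i) - u (i - j) * u j) * (b powi i * c powi j) = 0"
          using u_mult_u[OF 4] by simp
        with 4 show ?thesis by (simp add: p hb_def hc_def d_def algebra_simps)
      qed (auto simp: p hb_def hc_def d_def x_def power_int_mult_distrib power2_eq_square mult_ac)
    qed
    ultimately have "(d has_sum S) UNIV" by (simp only: S_def diff_conv_add_uminus)
    then show ?thesis
      by (subst (asm) has_sum_inj_support[symmetric, where g = "\<lambda>i. (i, i)"])
         (auto simp: d_def inj_on_def)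
  qed
  ultimately have "((\<lambda>i. conv i * x powi i + (u i)\<^sup>2 * x powi i) has_sum zeta x * zeta x + S) UNIV"
    by (rule has_sum_add)
  \<comment> \<open>The remaining coefficients i u(i) + u(i) u(-i), with the constant term, are
    those of \<open>wp x - 2 * lambert2 1\<close>.\<close>
  moreover have "((\<lambda>i. of_int i * u i * x powi i + - (- (u i * u (- i)) * x powi i) +
      (if i = 0 then - 2 * lambert2 1 else 0)) has_sum
      (x / (1 - x)\<^sup>2 + nlambert x + nlambert (inverse x)) + - (lambert2 x + lambert2 (inverse x)) + - 2 * lambert2 1) UNIV"
    using x inv
    by (intro has_sum_add has_sum_nlambert_int has_sum_uminusI has_sum_lambert2_int has_sum_finite_neutralI[of "{0}"]) auto
  moreover have "conv i * x powi i + (u i)\<^sup>2 * x powi i =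
      of_int i * u i * x powi i + - (- (u i * u (- i)) * x powi i) +
      (if i = 0 then - 2 * lambert2 1 else 0)" for i
    by (simp add: conv_def algebra_simps)
  ultimately have "zeta x * zeta x + S = (x / (1 - x)\<^sup>2 + nlambert x + nlambert (inverse x)) + - (lambert2 x + lambert2 (inverse x)) + - 2 * lambert2 1"
    using has_sum_unique by (simp only:)
  then show ?thesis
    by (simp add: product_identity_def S_def wp_def x_def algebra_simps)
qed

section \<open>Analytic continuation to the annulus\<close>

lemma holomorphic_zeta:
  assumes g: "g holomorphic_on S"
    and S: "\<And>z. z \<in> S \<Longrightarrow> norm q < norm (g z) \<and> norm (g z) < inverse (norm q) \<and> g z \<noteq> 1"
  shows "(\<lambda>z. zeta (g z)) holomorphic_on S"
  unfolding zeta_def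
  by (intro holomorphic_intros holomorphic_lambert g) (use S annulusD in force)+

lemma holomorphic_wp:
  assumes g: "g holomorphic_on S"
    and S: "\<And>z. z \<in> S \<Longrightarrow> norm q < norm (g z) \<and> norm (g z) < inverse (norm q) \<and> g z \<noteq> 1"
  shows "(\<lambda>z. wp (g z)) holomorphic_on S"
  unfolding wp_def
  by (intro holomorphic_intros holomorphic_nlambert holomorphic_lambert2 g) (use S annulusD in force)+

lemma product_identity_sym: "product_identity b c \<longleftrightarrow> product_identity c b"
  by (simp add: product_identity_def mult_ac add_ac)

text \<open>Identity theorem in the second variable on a punctured annulus. The known region is the
  hypothesis \<open>near\<close>, so that the lemma can be used twice with the variables
  exchanged.\<close>

lemma product_identity_extend:
  assumes b: "norm q < norm b" "norm b < inverse (norm q)" "b \<noteq> 1"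
    and near: "\<And>c. norm q < norm c \<Longrightarrow> norm c < 1 \<Longrightarrow> norm q < norm (b * c) \<Longrightarrow>
      norm (b * c) < inverse (norm q) \<Longrightarrow> b * c \<noteq> 1 \<Longrightarrow> product_identity b c"
    and c: "norm q < norm c" "norm c < inverse (norm q)" "c \<noteq> 1"
    and bc: "norm q < norm (b * c)" "norm (b * c) < inverse (norm q)" "b * c \<noteq> 1"
  shows "product_identity b c"
proof -
  \<comment> \<open>\<open>r1\<close> and \<open>r2\<close> bound the annulus of those z for which z
    and b z both lie in |q| < |.| < 1/|q|. The deleted points 1 and 1/b are the poles; 1 is already
    outside \<open>V\<close>.\<close>
  define r1 where "r1 = max (norm q) (norm q / norm b)"
  define r2 where "r2 = min (inverse (norm q)) (inverse (norm q) / norm b)"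
  define U where "U = {z. r1 < norm (z - 0) \<and> norm (z - 0) < r2} - {1, inverse b}"
  define V where "V = {z. r1 < norm (z - 0) \<and> norm (z - 0) < 1} - {inverse b}"
  have b0: "b \<noteq> 0" using annulusD[OF b(1,2)] by simp
  have r1: "0 < r1" "r1 < 1" using b norm_q_less q_nonzero b0 by (auto simp: r1_def less_max_iff_disj)
  have r2: "1 \<le> r2"
    using annulusD(2)[OF b(1,2)] norm_q_less b0 q_nonzero
    by (auto simp: r2_def pos_le_divide_eq inverse_eq_divide mult.commute)
  have r1_iff: "r1 < norm z \<longleftrightarrow> norm q < norm z \<and> norm q < norm (b * z)" for z
    using b0 by (auto simp: r1_def norm_mult field_simps)
  have r2_iff: "norm z < r2 \<longleftrightarrow> norm z < inverse (norm q) \<and> norm (b * z) < inverse (norm q)" for z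
    using b0 by (auto simp: r2_def norm_mult pos_less_divide_eq mult.commute)
  have U: "norm q < norm z" "norm z < inverse (norm q)" "z \<noteq> 1" "z \<noteq> 0"
    "norm q < norm (b * z)" "norm (b * z) < inverse (norm q)" "b * z \<noteq> 1" if "z \<in> U" for z
  proof -
    have "z = inverse b" if "b * z = 1" using that by (metis inverse_unique)
    then show "norm q < norm z" "norm z < inverse (norm q)" "z \<noteq> 1" 
      "norm q < norm (b * z)" "norm (b * z) < inverse (norm q)" "b * z \<noteq> 1" 
      using that r1_iff[of z] r2_iff[of z] by (auto simp: U_def)
    then show "z \<noteq> 0" by auto
  qed
  have open_annulus: "open {z::complex. r < norm (z - 0) \<and> norm (z - 0) < s}" for r s
    by (intro open_Collect_conj open_Collect_less continuous_intros)
  let ?lhs = "\<lambda>c. (zeta b - zeta (b * c)) * (zeta c - zeta (b * c))"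
  let ?rhs = "\<lambda>c. wp (b * c) + (lambert2 b + lambert2 (inverse b)) + (lambert2 c + lambert2 (inverse c)) - 2 * lambert2 1"
  have "V \<subseteq> U" using r2 by (auto simp: U_def V_def)
  have "?lhs c = ?rhs c"
  proof (rule analytic_continuation_open[of V U ?lhs ?rhs])
    show "open V" "open U"
      unfolding U_def V_def by (intro open_Diff open_annulus finite_imp_closed; simp)+
    show "connected U"
      unfolding U_def by (intro connected_open_delete_finite open_annulus connected_annulus) auto
    show "V \<subseteq> U" by fact
    obtain t where t: "r1 < t" "t < 1" using r1 dense by blast
    \<comment> \<open>Only one point is deleted from \<open>V\<close>, so t or -t survives.\<close>
    then have "of_real t \<in> V \<or> - of_real t \<in> V"
      using r1 by (auto simp: V_def)
    then show "V \<noteq> {}" by blast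
    show "?lhs holomorphic_on U"
      by (intro holomorphic_intros holomorphic_zeta) (use U in auto)
    show "?rhs holomorphic_on U"
      by (intro holomorphic_intros holomorphic_wp holomorphic_lambert2) (use U annulusD in auto)
    show "c \<in> U" 
      using c bc b0 r1_iff[of c] r2_iff[of c] by (auto simp: U_def)
  next
    fix z assume "z \<in> V"
    with \<open>V \<subseteq> U\<close> have "product_identity b z"
      using U[of z] by (intro near) (auto simp: V_def)
    then show "?lhs z = ?rhs z"
      by (simp add: product_identity_def)
  qed
  then show ?thesis by (simp add: product_identity_def)
qed

lemma product_identity_annulus:
  assumes b: "norm q < norm b" "norm b < inverse (norm q)" "b \<noteq> 1"
    and c: "norm q < norm c" "norm c < inverse (norm q)" "c \<noteq> 1"
    and bc: "norm q < norm (b * c)" "norm (b * c) < inverse (norm q)" "b * c \<noteq> 1"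
  shows "product_identity b c"
proof (rule product_identity_extend[OF b _ c bc])
  fix c assume c: "norm q < norm c" "norm c < 1"
    and bc: "norm q < norm (b * c)" "norm (b * c) < inverse (norm q)" "b * c \<noteq> 1"
  \<comment> \<open>Now c is held fixed in the disc and the other variable moves, starting from the
    disc.\<close>
  have "product_identity c b"
  proof (rule product_identity_extend[OF _ _ _ _ b])
    show "product_identity c z" if "norm z < 1" "norm q < norm (c * z)" for z
      by (rule product_identity_near[OF c(2) that])
  qed (use c bc norm_q_less_inverse in \<open>auto simp: mult.commute\<close>)
  then show "product_identity b c" by (simp add: product_identity_sym)
qed

end

section \<open>Return to the series of the statement\<close>

theorem proposition2:
  fixes q b c :: complex
  assumes "0 < norm q" and "norm q < 1"
    and "b \<noteq> 0" and "c \<noteq> 0"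
    and "norm q < norm b" and "norm b < inverse (norm q)"
    and "norm q < norm c" and "norm c < inverse (norm q)"
    and "norm q < norm (b * c)" and "norm (b * c) < inverse (norm q)"
    and "b \<noteq> 1" and "c \<noteq> 1" and "b * c \<noteq> 1"
  shows
    "((\<Sum>r. b * q ^ r / (1 - b * q ^ r))
        - (\<Sum>r. inverse b * q ^ Suc r / (1 - inverse b * q ^ Suc r))
        - (\<Sum>r. b * c * q ^ r / (1 - b * c * q ^ r))
        + (\<Sum>r. inverse b * inverse c * q ^ Suc r / (1 - inverse b * inverse c * q ^ Suc r)))
     * ((\<Sum>r. c * q ^ r / (1 - c * q ^ r))
        - (\<Sum>r. inverse c * q ^ Suc r / (1 - inverse c * q ^ Suc r))
        - (\<Sum>r. b * c * q ^ r / (1 - b * c * q ^ r))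
        + (\<Sum>r. inverse b * inverse c * q ^ Suc r / (1 - inverse b * inverse c * q ^ Suc r)))
     = b * c / (1 - b * c)\<^sup>2
        + (\<Sum>r. of_nat (Suc r)
              * (b ^ Suc r * c ^ Suc r + inverse b ^ Suc r * inverse c ^ Suc r)
              * (q ^ Suc r / (1 - q ^ Suc r)))
        + (\<Sum>r. (b ^ Suc r + inverse b ^ Suc r + c ^ Suc r + inverse c ^ Suc r
                - b ^ Suc r * c ^ Suc r - inverse b ^ Suc r * inverse c ^ Suc r - 2)
              * (q ^ Suc r / (1 - q ^ Suc r)\<^sup>2))"
proof -
  interpret nome q by standard (use assms(1,2) in auto)
  note b = annulusD[OF assms(5,6)] and c = annulusD[OF assms(7,8)] and bc = annulusD[OF assms(9,10)]
  have inv: "inverse (b * c) = inverse b * inverse c" by simp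
  have nlambert_sums: "(\<lambda>n. nlam n * z ^ n) sums nlambert z" if "norm z * norm q < 1" for z
    using has_sum_imp_sums[OF has_sum_nlambert[OF that]] .
  have lambert2_sums: "(\<lambda>n. lam2 n * z ^ n) sums lambert2 z" if "norm z * norm q < 1" for z
    using has_sum_imp_sums[OF has_sum_lambert2[OF that]] .
  \<comment> \<open>\<open>?f\<close> and \<open>?g\<close> start at index 0, where both vanish
    (\<open>?g\<close> by division by zero), so they shift to sums over r >= 1.\<close>
  let ?f = "\<lambda>n. of_nat n * (b ^ n * c ^ n + inverse b ^ n * inverse c ^ n) * (q ^ n / (1 - q ^ n))"
  have "(\<lambda>n. nlam n * (b * c) ^ n + nlam n * inverse (b * c) ^ n) sums (nlambert (b * c) + nlambert (inverse (b * c)))"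
    by (intro sums_add nlambert_sums bc)
  moreover have "nlam n * (b * c) ^ n + nlam n * inverse (b * c) ^ n = ?f n" for n
    unfolding inv power_mult_distrib by (simp only: nlam_def lam_def algebra_simps)
  ultimately have "?f sums (nlambert (b * c) + nlambert (inverse (b * c)))" by simp
  then have 1: "(\<Sum>r. ?f (Suc r)) = nlambert (b * c) + nlambert (inverse (b * c))"
    by (rule suminf_Suc_eq) simp
  let ?g = "\<lambda>n. (b ^ n + inverse b ^ n + c ^ n + inverse c ^ n
      - b ^ n * c ^ n - inverse b ^ n * inverse c ^ n - 2) * (q ^ n / (1 - q ^ n)\<^sup>2)"
  have "norm (1::complex) * norm q < 1" using assms(2) by simp
  \<comment> \<open>The constant -2 in \<open>?g\<close> is treated as two copies of the series at z
    = 1.\<close>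
  then have "(\<lambda>n. lam2 n * b ^ n + lam2 n * inverse b ^ n + lam2 n * c ^ n + lam2 n * inverse c ^ n
      - lam2 n * (b * c) ^ n - lam2 n * inverse (b * c) ^ n - (lam2 n * 1 ^ n + lam2 n * 1 ^ n)) sums
      (lambert2 b + lambert2 (inverse b) + lambert2 c + lambert2 (inverse c) - lambert2 (b * c) - lambert2 (inverse (b * c)) - (lambert2 1 + lambert2 1))"
    by (intro sums_add sums_diff lambert2_sums b c bc)
  moreover have "lam2 n * b ^ n + lam2 n * inverse b ^ n + lam2 n * c ^ n + lam2 n * inverse c ^ n
      - lam2 n * (b * c) ^ n - lam2 n * inverse (b * c) ^ n - (lam2 n * 1 ^ n + lam2 n * 1 ^ n) = ?g n" for n
    unfolding inv power_mult_distrib lam2_def[symmetric] by (simp add: algebra_simps del: power_inverse)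
  ultimately have "?g sums
      (lambert2 b + lambert2 (inverse b) + lambert2 c + lambert2 (inverse c) - lambert2 (b * c) - lambert2 (inverse (b * c)) - (lambert2 1 + lambert2 1))"
    by simp
  then have 2: "(\<Sum>r. ?g (Suc r)) =
      lambert2 b + lambert2 (inverse b) + lambert2 c + lambert2 (inverse c) - lambert2 (b * c) - lambert2 (inverse (b * c)) - (lambert2 1 + lambert2 1)"
    by (rule suminf_Suc_eq) simp
  have "product_identity b c" by (rule product_identity_annulus) (use assms in auto)
  then show ?thesis
    unfolding 1 2 product_identity_def wp_def
      zeta_eq[OF assms(5,6)] zeta_eq[OF assms(7,8)] zeta_eq[OF assms(9,10)] inv
    by (simp add: algebra_simps)
qed

end
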